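(* Let $f_1$ and $f_2$ be proper $n$-dimensional affine hyperspheres in $\mathbb{R}^{n+1}$ (centred at the origin, defined on open subsets of $\mathbb{R}^n$) and let $f$ be the $\widetilde{J}$-tangent affine hypersphere in $\mathbb{R}^{2n+2}$ given by $$f(x,y,z)=\Big(\widetilde{J}\circ(f_1\times f_2)+f_1\times(-f_2)\Big)(x,y)\cosh z-\Big((f_1\times f_2)+\widetilde{J}\circ(f_1\times(-f_2))\Big)(x,y)\sinh z,$$ where $x=(x_1,\ldots,x_n)$, $y=(y_1,\ldots,y_n)$. Then $f$ is, up to an equiaffine transformation of $\mathbb{R}^{2n+2}$, the Calabi product $CP(f_1,f_2)$ of $f_1$ and $f_2$.
   Context: Let $n\ge1$. $\widetilde{J}$ is the standard para-complex structure on $\mathbb{R}^{2n+2}=\mathbb{R}^{n+1}\times\mathbb{R}^{n+1}$: $\widetilde{J}(x_1,\ldots,x_{n+1},y_1,\ldots,y_{n+1})=(y_1,\ldots,y_{n+1},x_1,\ldots,x_{n+1})$; $(f_1\times f_2)(x,y)=(f_1(x),f_2(y))$. The Calabi product of two proper $n$-dimensional affine hyperspheres $\psi_1,\psi_2$ in $\mathbb{R}^{n+1}$ is $\psi(x,y,z)=(c_1e^{az}\psi_1(x),c_2e^{-az}\psi_2(y))\in\mathbb{R}^{2n+2}$ with nonzero constants $c_1,c_2,a$; $CP(f_1,f_2)$ denotes the Calabi product of $f_1$ and $f_2$ with $c_1=2$, $c_2=1$, $a=-1$, i.e. $CP(f_1,f_2)(x,y,z)=(2e^{-z}f_1(x),e^{z}f_2(y))$.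 An equiaffine transformation is one whose linear part has determinant $\pm1$. A proper affine hypersphere is a nondegenerate hypersurface immersion $\psi\colon M^N\to\mathbb{R}^{N+1}$ whose Blaschke affine normal field $C$ satisfies $\mathrm{D}_XC=-\psi_*(SX)$ with $S=\lambda I$, $\lambda\ne0$ constant ($\mathrm{D}$ the flat connection); it is centred at the origin if $C=-\lambda\psi$. An affine hypersphere $f\colon M^{2n+1}\to\mathbb{R}^{2n+2}$ is $\widetilde{J}$-tangent if its Blaschke field $C$ satisfies $\widetilde{J}C_x\in f_*(T_xM)$ for all $x$. *)

theory Defs
  imports "HOL-Analysis.Analysis"
begin

primrec Ck_on :: "nat \<Rightarrow> 'a::euclidean_space set \<Rightarrow> ('a \<Rightarrow> 'b::real_normed_vector) \<Rightarrow> bool" where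
  "Ck_on 0 U f \<longleftrightarrow> continuous_on U f"
| "Ck_on (Suc k) U f \<longleftrightarrow>
     (\<forall>p\<in>U. f differentiable (at p)) \<and>
     (\<forall>X. Ck_on k U (\<lambda>p. frechet_derivative f (at p) X))"

definition smooth_on :: "'a::euclidean_space set \<Rightarrow> ('a \<Rightarrow> 'b::real_normed_vector) \<Rightarrow> bool" where
  "smooth_on U f \<longleftrightarrow> open U \<and> (\<forall>k. Ck_on k U f)"

text \<open>
  The source manifold is an open subset \<open>U\<close> of a Euclidean space.  The pushforward
  \<open>f\<^sub>* X\<close> of a tangent vector is \<open>frechet_derivative f (at p) X\<close>, and the flat connection
  \<open>D\<close> of the target is ordinary differentiation of vector-valued functions.
\<close>

abbreviation pushforward ::
  "('a::euclidean_space \<Rightarrow> 'b::real_normed_vector) \<Rightarrow> 'a \<Rightarrow> 'a \<Rightarrow> 'b" where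
  "pushforward f p \<equiv> frechet_derivative f (at p)"

definition hypersurface_immersion ::
  "'a::euclidean_space set \<Rightarrow> ('a \<Rightarrow> real^'m) \<Rightarrow> bool" where
  "hypersurface_immersion U f \<longleftrightarrow>
     CARD('m) = DIM('a) + 1 \<and> smooth_on U f \<and> (\<forall>p\<in>U. inj (pushforward f p))"

definition transversal_field ::
  "'a::euclidean_space set \<Rightarrow> ('a \<Rightarrow> real^'m) \<Rightarrow> ('a \<Rightarrow> real^'m) \<Rightarrow> bool" where
  "transversal_field U f C \<longleftrightarrow>
     smooth_on U C \<and> (\<forall>p\<in>U. C p \<notin> range (pushforward f p))"

text \<open>
  The affine fundamental form \<open>h\<close> is the transversal coefficient in the Gauss formula
  \<open>D\<^sub>X (f\<^sub>* Y) = f\<^sub>* (\<nabla>\<^sub>X Y) + h(X,Y) C\<close>.  Since \<open>h\<close> is tensorial, it is enough to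
  use constant vector fields \<open>X\<close> and \<open>Y\<close>.
\<close>

definition affine_form ::
  "('a::euclidean_space \<Rightarrow> real^'m) \<Rightarrow> ('a \<Rightarrow> real^'m) \<Rightarrow> 'a \<Rightarrow> 'a \<Rightarrow> 'a \<Rightarrow> real" where
  "affine_form f C p X Y =
     (THE t. frechet_derivative (\<lambda>q. pushforward f q Y) (at p) X - t *\<^sub>R C p
               \<in> range (pushforward f p))"

definition nondegenerate_wrt ::
  "'a::euclidean_space set \<Rightarrow> ('a \<Rightarrow> real^'m) \<Rightarrow> ('a \<Rightarrow> real^'m) \<Rightarrow> bool" where
  "nondegenerate_wrt U f C \<longleftrightarrow>
     (\<forall>p\<in>U. \<forall>X. X \<noteq> 0 \<longrightarrow> (\<exists>Y. affine_form f C p X Y \<noteq> 0))"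

text \<open>The Leibniz determinant of a square array indexed by a finite set rather than by a type.\<close>

definition det_on :: "'i set \<Rightarrow> ('i \<Rightarrow> 'i \<Rightarrow> real) \<Rightarrow> real" where
  "det_on I A = (\<Sum>\<pi> | \<pi> permutes I. of_int (sign \<pi>) * (\<Prod>i\<in>I. A i (\<pi> i)))"

text \<open>
  \<open>C\<close> is a Blaschke field if it is equiaffine (\<open>D\<^sub>X C\<close> is tangent) and the induced volume
  element \<open>det(f\<^sub>* X\<^sub>1, \<dots>, f\<^sub>* X\<^sub>N, C)\<close> agrees up to sign with the volume element
  \<open>\<bar>det (h(X\<^sub>i, X\<^sub>j))\<bar>\<^bsup>1/2\<^esup>\<close> of \<open>h\<close>.  The \<open>N + 1\<close> rows of the first determinant are
  indexed by \<open>'m\<close>: the row \<open>k\<close> holds \<open>C\<close>, the other \<open>N\<close> rows hold the tangent vectors.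
  The position \<open>k\<close> affects the sign only.  The field is thereby determined up to sign.
\<close>

definition blaschke_field ::
  "'a::euclidean_space set \<Rightarrow> ('a \<Rightarrow> real^'m) \<Rightarrow> ('a \<Rightarrow> real^'m) \<Rightarrow> bool" where
  "blaschke_field U f C \<longleftrightarrow>
     transversal_field U f C \<and>
     (\<forall>p\<in>U. \<forall>X. frechet_derivative C (at p) X \<in> range (pushforward f p)) \<and>
     (\<forall>p\<in>U. \<forall>(k::'m) (X::'m \<Rightarrow> 'a).
        \<bar>det (\<chi> i. if i = k then C p else pushforward f p (X i))\<bar> =
        sqrt \<bar>det_on (- {k}) (\<lambda>i j. affine_form f C p (X i) (X j))\<bar>)"

text \<open>An affine hypersphere with Blaschke field \<open>C\<close> and shape operator \<open>S = lam I\<close>.\<close>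

definition affine_hypersphere_with ::
  "'a::euclidean_space set \<Rightarrow> ('a \<Rightarrow> real^'m) \<Rightarrow> ('a \<Rightarrow> real^'m) \<Rightarrow> real \<Rightarrow> bool" where
  "affine_hypersphere_with U f C lam \<longleftrightarrow>
     hypersurface_immersion U f \<and> blaschke_field U f C \<and> nondegenerate_wrt U f C \<and>
     (\<forall>p\<in>U. \<forall>X. frechet_derivative C (at p) X = - pushforward f p (lam *\<^sub>R X))"

definition centred_proper_affine_hypersphere ::
  "'a::euclidean_space set \<Rightarrow> ('a \<Rightarrow> real^'m) \<Rightarrow> bool" where
  "centred_proper_affine_hypersphere U f \<longleftrightarrow>
     (\<exists>C lam. lam \<noteq> 0 \<and> affine_hypersphere_with U f C lam \<and> (\<forall>p\<in>U. C p = - lam *\<^sub>R f p))"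

text \<open>
  \<open>\<real>\<^bsup>2n+2\<^esup> = \<real>\<^bsup>n+1\<^esup> \<times> \<real>\<^bsup>n+1\<^esup>\<close> is represented by \<open>real^('m + 'm)\<close> with \<open>CARD('m) = n + 1\<close>:
  the coordinates \<open>Inl\<close> are the first factor, the coordinates \<open>Inr\<close> the second.
\<close>

definition join :: "real^'m \<Rightarrow> real^'m \<Rightarrow> real^('m::finite + 'm)" where
  "join u v = (\<chi> i. case i of Inl k \<Rightarrow> u $ k | Inr k \<Rightarrow> v $ k)"

definition J_tilde :: "real^('m::finite + 'm) \<Rightarrow> real^('m + 'm)" where
  "J_tilde w = (\<chi> i. case i of Inl k \<Rightarrow> w $ Inr k | Inr k \<Rightarrow> w $ Inl k)"

definition prod_map ::
  "('a \<Rightarrow> real^'m) \<Rightarrow> ('b \<Rightarrow> real^'m) \<Rightarrow> 'a \<times> 'b \<Rightarrow> real^('m::finite + 'm)" where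
  "prod_map f1 f2 = (\<lambda>(x, y). join (f1 x) (f2 y))"

definition J_tangent_affine_hypersphere ::
  "'a::euclidean_space set \<Rightarrow> ('a \<Rightarrow> real^('m::finite + 'm)) \<Rightarrow> bool" where
  "J_tangent_affine_hypersphere U f \<longleftrightarrow>
     (\<exists>C lam. affine_hypersphere_with U f C lam \<and>
            (\<forall>p\<in>U. J_tilde (C p) \<in> range (pushforward f p)))"

definition calabi_product ::
  "real \<Rightarrow> real \<Rightarrow> real \<Rightarrow> ('a \<Rightarrow> real^'m) \<Rightarrow> ('b \<Rightarrow> real^'m) \<Rightarrow>
   'a \<times> 'b \<times> real \<Rightarrow> real^('m::finite + 'm)" where
  "calabi_product c1 c2 a f1 f2 =
     (\<lambda>(x, y, z). join ((c1 * exp (a * z)) *\<^sub>R f1 x) ((c2 * exp (- a * z)) *\<^sub>R f2 y))"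

definition CP ::
  "('a \<Rightarrow> real^'m) \<Rightarrow> ('b \<Rightarrow> real^'m) \<Rightarrow> 'a \<times> 'b \<times> real \<Rightarrow> real^('m::finite + 'm)" where
  "CP = calabi_product 2 1 (- 1)"

definition equiaffine_transformation :: "(real^'k \<Rightarrow> real^'k) \<Rightarrow> bool" where
  "equiaffine_transformation T \<longleftrightarrow>
     (\<exists>L b. linear L \<and> \<bar>det (matrix L)\<bar> = 1 \<and> T = (\<lambda>v. L v + b))"

end

(* Expanding cosh and sinh gives f = (exp (-z) f1 + exp z f2, exp (-z) f1 - exp z f2), which is the
   image of CP f1 f2 = (2 exp (-z) f1, exp z f2) under (u, v) \<mapsto> (u/2 + v, u/2 - v).  This linear
   map is a composition of three involutions, so its determinant is 1 or -1. *)

theory Submission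
  imports Defs
begin

text \<open>The Kronecker product of the 2x2 matrix with rows \<open>(a, b)\<close> and
  \<open>(c, d)\<close> with the identity of \<open>real^'m\<close>, so that composing such maps is
  multiplying 2x2 matrices.\<close>

definition block_map ::
  "real \<Rightarrow> real \<Rightarrow> real \<Rightarrow> real \<Rightarrow> real^('m::finite + 'm) \<Rightarrow> real^('m + 'm)" where
  "block_map a b c d w =
     (\<chi> i. case i of Inl k \<Rightarrow> a * w $ Inl k + b * w $ Inr k | Inr k \<Rightarrow> c * w $ Inl k + d * w $ Inr k)"

lemma linear_block_map: "linear (block_map a b c d)"
  by (rule linearI) (auto simp: block_map_def vec_eq_iff algebra_simps split: sum.split)

lemma block_map_comp:
  "block_map a b c d \<circ> block_map a' b' c' d' =
     block_map (a * a' + b * c') (a * b' + b * d') (c * a' + d * c') (c * b' + d * d')"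
  by (auto simp: block_map_def fun_eq_iff vec_eq_iff algebra_simps split: sum.split)

lemma block_map_id: "block_map 1 0 0 1 = id"
  by (auto simp: block_map_def fun_eq_iff vec_eq_iff split: sum.split)

text \<open>The determinant is multiplicative, so that of an involution squares to 1.\<close>

lemma abs_det_involution:
  fixes L :: "real^'k \<Rightarrow> real^'k"
  assumes "linear L" and "L \<circ> L = id"
  shows "\<bar>det (matrix L)\<bar> = 1"
proof -
  have "matrix L ** matrix L = mat 1"
    using assms by (metis matrix_compose matrix_id_mat_1)
  then have "\<bar>det (matrix L)\<bar>\<^sup>2 = 1"
    by (metis det_I det_mul power2_abs power2_eq_square)
  then show ?thesis
    by (auto simp: power2_eq_1_iff)
qed

lemma abs_det_comp:
  fixes L K :: "real^'k \<Rightarrow> real^'k"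
  assumes "linear L" and "linear K"
  shows "\<bar>det (matrix (L \<circ> K))\<bar> = \<bar>det (matrix L)\<bar> * \<bar>det (matrix K)\<bar>"
  using assms by (simp add: matrix_compose det_mul abs_mult)

text \<open>The 2x2 matrix has determinant -1, so the sign here depends on the parity of
  \<open>CARD('m)\<close>. Factoring into involutions yields the absolute value without expanding a
  block determinant.\<close>

lemma abs_det_block_map:
  "\<bar>det (matrix (block_map (1/2) 1 (1/2) (- 1) :: real^('m::finite + 'm) \<Rightarrow> _))\<bar> = 1"
proof -
  \<comment> \<open>On pairs: \<open>N\<close> is (u, v) \<mapsto> (-u, v), \<open>A\<close> is (u,
    v) \<mapsto> (v - u, v), \<open>B\<close> is (u, v) \<mapsto> (u, u/2 - v).\<close>
  define N A B :: "real^('m + 'm) \<Rightarrow> real^('m + 'm)"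
    where "N = block_map (- 1) 0 0 1" and "A = block_map (- 1) 1 0 1"
      and "B = block_map 1 0 (1/2) (- 1)"
  have lin: "linear N" "linear A" "linear B"
    by (simp_all add: N_def A_def B_def linear_block_map)
  \<comment> \<open>Writing \<open>id\<close> as a block map reduces each claim to arithmetic on the
    four coefficients.\<close>
  have "N \<circ> N = id" "A \<circ> A = id" "B \<circ> B = id"
    by (simp_all add: N_def A_def B_def block_map_comp flip: block_map_id)
  then have "\<bar>det (matrix N)\<bar> = 1" "\<bar>det (matrix A)\<bar> = 1" "\<bar>det (matrix B)\<bar> = 1"
    using lin by (simp_all add: abs_det_involution)
  moreover have "block_map (1/2) 1 (1/2) (- 1) = N \<circ> (A \<circ> B)"
    by (simp add: N_def A_def B_def block_map_comp)
  ultimately show ?thesis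
    using lin by (simp add: abs_det_comp linear_compose)
qed

text \<open>Uses cosh z - sinh z = exp (-z) and cosh z + sinh z = exp z; the entries 1/2 cancel the
  constant 2 in \<open>CP\<close>.\<close>

lemma J_tilde_eq_calabi_product:
  "cosh z *\<^sub>R ((J_tilde \<circ> prod_map f1 f2) (x, y) + prod_map f1 (\<lambda>y. - f2 y) (x, y))
     - sinh z *\<^sub>R (prod_map f1 f2 (x, y) + (J_tilde \<circ> prod_map f1 (\<lambda>y. - f2 y)) (x, y))
   = block_map (1/2) 1 (1/2) (- 1) (CP f1 f2 (x, y, z))"
  by (auto simp: CP_def calabi_product_def block_map_def prod_map_def J_tilde_def join_def
      vec_eq_iff cosh_def sinh_def field_simps split: sum.split)

theorem corollary5p1:
  fixes f1 f2 :: "real^'n \<Rightarrow> real^'m"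
    and U1 U2 :: "(real^'n) set"
    and f :: "(real^'n) \<times> (real^'n) \<times> real \<Rightarrow> real^('m + 'm)"
  assumes "CARD('m) = CARD('n) + 1"
    and "open U1" and "open U2"
    and "centred_proper_affine_hypersphere U1 f1"
    and "centred_proper_affine_hypersphere U2 f2"
    and "J_tangent_affine_hypersphere (U1 \<times> U2 \<times> UNIV) f"
    and "\<And>x y z. x \<in> U1 \<Longrightarrow> y \<in> U2 \<Longrightarrow>
      f (x, y, z) =
        cosh z *\<^sub>R ((J_tilde \<circ> prod_map f1 f2) (x, y) + prod_map f1 (\<lambda>y. - f2 y) (x, y))
      - sinh z *\<^sub>R (prod_map f1 f2 (x, y) + (J_tilde \<circ> prod_map f1 (\<lambda>y. - f2 y)) (x, y))"
  shows "\<exists>T. equiaffine_transformation T \<and>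
    (\<forall>x\<in>U1. \<forall>y\<in>U2. \<forall>z. f (x, y, z) = T (CP f1 f2 (x, y, z)))"
proof (intro exI conjI ballI allI)
  \<comment> \<open>This fixes the witness \<open>T\<close>: one linear map for all points, with
    translation part 0.\<close>
  show "equiaffine_transformation (block_map (1/2) 1 (1/2) (- 1) :: real^('m + 'm) \<Rightarrow> _)"
    unfolding equiaffine_transformation_def
    by (intro exI[of _ "block_map (1/2) 1 (1/2) (- 1)"] exI[of _ 0])
      (simp add: linear_block_map abs_det_block_map)
  show "f (x, y, z) = block_map (1/2) 1 (1/2) (- 1) (CP f1 f2 (x, y, z))"
    if "x \<in> U1" "y \<in> U2" for x y z
    using assms(7)[OF that] J_tilde_eq_calabi_product by metis
qed

end
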